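(* Let $D_3:=\{\{1,2,3\},\{-1,-2,-3\},\{-1,2\},\{-2,3\},\{-3,1\}\}$. Then $D_3$ is a clause-irreducible unsatisfiable hitting clause-set with $\delta(D_3)=2$, and every clause-irreducible unsatisfiable hitting clause-set $F$ with $\delta(F)=2$ is isomorphic to $D_3$.
   Context: Variables are positive integers, literals are nonzero integers, the complement of $x$ is $\overline{x}=-x$. A clause is a finite set of literals with no pair $x,\overline{x}$. A clause-set is a finite set of clauses; $\top$ is the empty clause-set. $n(F)$ is the number of variables occurring in $F$, $c(F)=|F|$, $\delta(F)=c(F)-n(F)$. $F$ is satisfiable if some clause meets every clause of $F$, otherwise unsatisfiable. $F$ is hitting if any two distinct clauses $C,D\in F$ have some $x\in C$ with $\overline{x}\in D$. A clause-set $F'\ne\top$ is a clause-factor if $\{D\setminus\bigcap F':D\in F'\}$ is unsatisfiable; a clause-factor of $F$ is a subset of $F$ which is a clause-factor; trivial if $c(F')=1$ or ($F'$ unsatisfiable and $F'=F$). $F$ is clause-irreducible if all its clause-factors are trivial. Clause-sets $F,G$ are isomorphic if there is a bijection $f$ from the literals over the variables of $F$ to those over the variables of $G$ with $f(\overline x)=\overline{f(x)}$ and $G=\{\{f(x):x\in C\}:C\in F\}$. *)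

theory Defs
  imports Main
begin

(* Literals are nonzero integers, complementation is integer negation, and the
   variable underlying a literal is its absolute value. *)

type_synonym literal = int

definition clause :: "literal set \<Rightarrow> bool" where
  "clause C \<longleftrightarrow> finite C \<and> 0 \<notin> C \<and> (\<forall>x\<in>C. - x \<notin> C)"

definition clause_set :: "literal set set \<Rightarrow> bool" where
  "clause_set F \<longleftrightarrow> finite F \<and> (\<forall>C\<in>F. clause C)"

definition vars :: "literal set set \<Rightarrow> int set" where
  "vars F = abs ` \<Union> F"

(* The literals over the variables of F, closed under complement: a literal need
   not itself occur in F. *)
definition lits :: "literal set set \<Rightarrow> literal set" where
  "lits F = {x. \<bar>x\<bar> \<in> vars F}"

definition deficiency :: "literal set set \<Rightarrow> int" where
  "deficiency F = int (card F) - int (card (vars F))"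

definition satisfiable :: "literal set set \<Rightarrow> bool" where
  "satisfiable F \<longleftrightarrow> (\<exists>C. clause C \<and> (\<forall>D\<in>F. C \<inter> D \<noteq> {}))"

abbreviation unsatisfiable :: "literal set set \<Rightarrow> bool" where
  "unsatisfiable F \<equiv> \<not> satisfiable F"

definition hitting :: "literal set set \<Rightarrow> bool" where
  "hitting F \<longleftrightarrow> (\<forall>C\<in>F. \<forall>D\<in>F. C \<noteq> D \<longrightarrow> (\<exists>x\<in>C. - x \<in> D))"

definition clause_factor :: "literal set set \<Rightarrow> bool" where
  "clause_factor F' \<longleftrightarrow>
     clause_set F' \<and> F' \<noteq> {} \<and> unsatisfiable {D - \<Inter> F' | D. D \<in> F'}"

definition clause_factor_of :: "literal set set \<Rightarrow> literal set set \<Rightarrow> bool" where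
  "clause_factor_of F' F \<longleftrightarrow> F' \<subseteq> F \<and> clause_factor F'"

definition trivial_factor :: "literal set set \<Rightarrow> literal set set \<Rightarrow> bool" where
  "trivial_factor F' F \<longleftrightarrow> card F' = 1 \<or> (unsatisfiable F' \<and> F' = F)"

definition clause_irreducible :: "literal set set \<Rightarrow> bool" where
  "clause_irreducible F \<longleftrightarrow> (\<forall>F'. clause_factor_of F' F \<longrightarrow> trivial_factor F' F)"

definition isomorphic :: "literal set set \<Rightarrow> literal set set \<Rightarrow> bool" where
  "isomorphic F G \<longleftrightarrow>
     (\<exists>f. bij_betw f (lits F) (lits G) \<and> (\<forall>x\<in>lits F. f (- x) = - f x) \<and>
          G = {{f x | x. x \<in> C} | C. C \<in> F})"

definition D3 :: "literal set set" where
  "D3 = {{1, 2, 3}, {-1, -2, -3}, {-1, 2}, {-2, 3}, {-3, 1}}"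

end

theory Submission
  imports Defs
begin

text \<open>
  A clause stands for the subcube of assignments falsifying it; an unsatisfiable hitting clause-set
  is a partition of the cube into subcubes, and a clause-factor is a part of it that partitions a
  subcube. Flipping \<open>v\<close> maps the subcubes with \<open>v\<close> onto those with \<open>-v\<close>.

  Assigning a variable \<open>v\<close> of minimal degree loses no other variable, so deficiency \<open>\<ge> 1\<close>
  follows by induction and each literal of \<open>v\<close> occurs at most \<open>\<delta>\<close> times. For an irreducible
  \<open>F\<close> with \<open>\<delta>(F) = 2\<close> a literal cannot occur only once, so there are two clauses with \<open>v\<close>
  and two with \<open>-v\<close>. Both pairs cover the same set once \<open>v\<close> is removed; irreducibility leaves
  only the shape \<open>v y -x R\<close>, \<open>v -y R\<close>, \<open>-v x -y R\<close>, \<open>-v -x R\<close>. Setting \<open>v\<close> to false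
  gives deficiency 1, whose tree structure shows that the missing part \<open>x y R\<close> is covered by
  clauses containing it, hence by irreducibility is itself a clause. These five clauses cover
  \<open>R\<close>, so \<open>R\<close> is empty and \<open>F\<close> consists of them.
\<close>

section \<open>Assignments, subcubes and unsatisfiability\<close>

text \<open>An assignment is given by the set of literals that it falsifies.\<close>

definition assignment :: "literal set \<Rightarrow> bool" where
  "assignment S \<longleftrightarrow> 0 \<notin> S \<and> (\<forall>x\<in>S. - x \<notin> S) \<and>
    (\<forall>x. x \<noteq> 0 \<longrightarrow> x \<in> S \<or> - x \<in> S)"

lemma assignment_consistent: "assignment S \<Longrightarrow> x \<in> S \<Longrightarrow> - x \<in> S \<Longrightarrow> False"
  by (simp add: assignment_def)

definition flip :: "literal \<Rightarrow> literal set \<Rightarrow> literal set" where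
  "flip v S = insert (- v) (S - {v})"

text \<open>The subcube of \<open>C\<close> lies in the union of the subcubes of \<open>K\<close>.
  For a clause-set \<open>K\<close> and \<open>C = {}\<close> this is unsatisfiability of
  \<open>K\<close>.\<close>

definition covers :: "literal set set \<Rightarrow> literal set \<Rightarrow> bool" where
  "covers K C \<longleftrightarrow> (\<forall>S. assignment S \<and> C \<subseteq> S \<longrightarrow> (\<exists>D\<in>K. D \<subseteq> S))"

text \<open>The result of setting \<open>l\<close> to true: satisfied clauses disappear, and the
  false literal \<open>- l\<close> is deleted from the others.\<close>

definition restr :: "literal \<Rightarrow> literal set set \<Rightarrow> literal set set" where
  "restr l H = (\<lambda>C. C - {- l}) ` {C \<in> H. l \<notin> C}"

definition uhit :: "literal set set \<Rightarrow> bool" where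
  "uhit H \<longleftrightarrow> clause_set H \<and> hitting H \<and> unsatisfiable H"

lemma assignment_flip: "assignment S \<Longrightarrow> v \<in> S \<Longrightarrow> assignment (flip v S)"
  unfolding assignment_def flip_def by (auto; metis minus_minus neg_equal_zero)

lemma clause_extends_assignment:
  assumes "clause C" obtains S where "assignment S" "C \<subseteq> S"
proof
  \<comment> \<open>The choice outside \<open>C\<close> is arbitrary: there the positive literal is
    falsified.\<close>
  show "assignment (C \<union> {x. x > 0 \<and> - x \<notin> C})"
    using assms unfolding assignment_def clause_def
    by (auto; metis linorder_neqE neg_0_less_iff_less minus_minus)
qed auto

lemma clause_insert:
  "clause (insert x C) \<longleftrightarrow> clause C \<and> x \<noteq> 0 \<and> - x \<notin> C"
  unfolding clause_def by (auto; metis minus_minus)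

lemma clause_subset: "clause C \<Longrightarrow> D \<subseteq> C \<Longrightarrow> clause D"
  unfolding clause_def by (auto intro: finite_subset)

lemma clause_set_subset: "clause_set F \<Longrightarrow> K \<subseteq> F \<Longrightarrow> clause_set K"
  unfolding clause_set_def by (auto intro: finite_subset)

text \<open>Inclusion of subcubes reverses inclusion of clauses: a literal \<open>x\<close> of
  \<open>C\<close> outside \<open>D\<close> could be made true while \<open>D\<close> stays
  falsified.\<close>

lemma subset_if_all_assignments:
  assumes "clause D" "clause C" "\<And>S. assignment S \<Longrightarrow> D \<subseteq> S \<Longrightarrow> C \<subseteq> S"
  shows "C \<subseteq> D"
proof
  fix x assume x: "x \<in> C"
  show "x \<in> D"
  proof (rule ccontr)
    assume "x \<notin> D"
    then have "clause (insert (- x) D)"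
      using assms(1,2) x by (auto simp: clause_insert clause_def)
    then obtain S where S: "assignment S" "insert (- x) D \<subseteq> S" by (rule clause_extends_assignment)
    with assms(3)[of S] x show False by (auto simp: assignment_def)
  qed
qed

lemma finite_vars: "clause_set F \<Longrightarrow> finite (vars F)"
  unfolding clause_set_def vars_def clause_def by auto

lemma finite_lits: "clause_set F \<Longrightarrow> finite (lits F)"
proof -
  assume "clause_set F"
  moreover have "lits F \<subseteq> vars F \<union> uminus ` vars F"
  proof
    fix x assume "x \<in> lits F"
    then have "\<bar>x\<bar> \<in> vars F" by (simp add: lits_def)
    then show "x \<in> vars F \<union> uminus ` vars F"
      by (cases "x \<ge> 0") (auto intro: image_eqI[of x uminus "- x"])
  qed
  ultimately show ?thesis
    using finite_vars by (meson finite_Un finite_imageI finite_subset)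
qed

lemma unsat_iff_covers: 
  assumes "clause_set F"
  shows "unsatisfiable F \<longleftrightarrow> covers F {}"
proof
  assume u: "unsatisfiable F"
  show "covers F {}"
    unfolding covers_def
  proof (intro allI impI)
    fix S :: "literal set" assume "assignment S \<and> {} \<subseteq> S"
    then have S: "assignment S" by simp
    \<comment> \<open>Clauses are finite but \<open>S\<close> is not, so the literals true under
      \<open>S\<close> are cut down to those over the variables of \<open>F\<close>.\<close>
    have "clause (uminus ` (S \<inter> lits F))"
      using S finite_lits[OF assms] unfolding clause_def assignment_def by auto
    then obtain D where D: "D \<in> F" "uminus ` (S \<inter> lits F) \<inter> D = {}"
      using u unfolding satisfiable_def by blast
    have "D \<subseteq> S"
    proof
      fix x assume x: "x \<in> D"
      then have "x \<noteq> 0" using assms D(1) by (auto simp: clause_set_def clause_def)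
      moreover have "- x \<in> lits F" using x D(1) by (auto simp: lits_def vars_def)
      ultimately show "x \<in> S" using D(2) x S unfolding assignment_def
        by (metis IntI disjoint_iff imageI minus_minus)
    qed
    with D(1) show "\<exists>D\<in>F. D \<subseteq> S" by blast
  qed
next
  assume c: "covers F {}"
  show "unsatisfiable F"
  proof
    assume "satisfiable F"
    then obtain A where A: "clause A" "\<forall>D\<in>F. A \<inter> D \<noteq> {}" by (auto simp: satisfiable_def)
    have "clause (uminus ` A)" using A(1) by (auto simp: clause_def)
    then obtain S where S: "assignment S" "uminus ` A \<subseteq> S" by (rule clause_extends_assignment)
    then obtain D where D: "D \<in> F" "D \<subseteq> S" using c by (auto simp: covers_def)
    then obtain x where "x \<in> A" "x \<in> D" using A(2) by blast
    with S D show False by (auto simp: assignment_def)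
  qed
qed

section \<open>Unsatisfiable hitting clause-sets as partitions of the cube\<close>

lemma uhit_obtain:
  assumes "uhit H" "assignment S" obtains D where "D \<in> H" "D \<subseteq> S"
  using assms unsat_iff_covers unfolding uhit_def covers_def by blast

lemma uhit_clause: "uhit H \<Longrightarrow> C \<in> H \<Longrightarrow> clause C"
  by (simp add: uhit_def clause_set_def)

lemma uhit_clash:
  assumes "uhit H" "C \<in> H" "D \<in> H" "C \<noteq> D" obtains x where "x \<in> C" "- x \<in> D"
  using assms unfolding uhit_def hitting_def by blast

lemma uhit_unique:
  assumes "uhit H" "assignment S" "C \<in> H" "D \<in> H" "C \<subseteq> S" "D \<subseteq> S" shows "C = D"
proof (rule ccontr)
  assume "C \<noteq> D"
  then obtain x where "x \<in> C" "- x \<in> D" using uhit_clash assms by metis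
  with assms assignment_consistent show False by blast
qed

text \<open>A clause falsified after the flip but lacking \<open>- v\<close> was falsified before it
  too, hence equals \<open>C\<close>, which is impossible because \<open>C\<close> contains
  \<open>v\<close>.\<close>

lemma flip_falsified:
  assumes "uhit H" "assignment S" "C \<in> H" "C \<subseteq> S" "v \<in> C"
  obtains D where "D \<in> H" "- v \<in> D" "D \<subseteq> flip v S"
proof -
  have "assignment (flip v S)" using assms assignment_flip by blast
  with assms(1) obtain D where D: "D \<in> H" "D \<subseteq> flip v S" by (rule uhit_obtain)
  have "- v \<in> D"
  proof (rule ccontr)
    assume "- v \<notin> D"
    then have "D \<subseteq> S" "v \<notin> D" using D(2) assms(2,4,5) by (auto simp: flip_def assignment_def)
    with uhit_unique[OF assms(1,2,3) D(1) assms(4)] assms(5) show False by simp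
  qed
  with D show ?thesis using that by blast
qed

lemma complement_occurs:
  assumes "uhit H" "C \<in> H" "v \<in> C" obtains D where "D \<in> H" "- v \<in> D"
proof -
  obtain S where "assignment S" "C \<subseteq> S"
    using clause_extends_assignment uhit_clause assms by metis
  with assms flip_falsified that show ?thesis by metis
qed

lemma var_literal_occurs:
  assumes "uhit H" "\<bar>l\<bar> \<in> vars H" obtains D where "D \<in> H" "l \<in> D"
proof -
  obtain C x where C: "C \<in> H" "x \<in> C" "\<bar>x\<bar> = \<bar>l\<bar>" using assms(2) by (auto simp: vars_def)
  then have "x = l \<or> - x = l" by arith
  then show ?thesis
    using complement_occurs[OF assms(1) C(1,2)] C that by metis
qed

section \<open>Assigning a literal\<close>

lemma uhit_restr:
  assumes "uhit H" "l \<noteq> 0" shows "uhit (restr l H)"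
proof -
  have cs: "clause_set (restr l H)"
    using assms by (auto simp: uhit_def restr_def clause_set_def intro: clause_subset)
  moreover have "hitting (restr l H)"
    unfolding hitting_def
  proof (intro ballI impI)
    fix C D assume CD: "C \<in> restr l H" "D \<in> restr l H" "C \<noteq> D"
    then obtain C' D' where *: "C' \<in> H" "D' \<in> H" "C = C' - {- l}" "D = D' - {- l}"
      "l \<notin> C'" "l \<notin> D'" by (auto simp: restr_def)
    with CD(3) have "C' \<noteq> D'" by auto
    then obtain x where "x \<in> C'" "- x \<in> D'" using * assms(1) uhit_clash by metis
    with * show "\<exists>x\<in>C. - x \<in> D" by (metis DiffI empty_iff insert_iff minus_minus)
  qed
  moreover have "covers (restr l H) {}"
    unfolding covers_def
  proof (intro allI impI)
    fix S :: "literal set" assume "assignment S \<and> {} \<subseteq> S"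
    then have S: "assignment S" by simp
    \<comment> \<open>\<open>T\<close> moves \<open>S\<close> into the half of the cube where
      \<open>l\<close> is true, changing at most the variable of \<open>l\<close>.\<close>
    define T where "T = (if l \<in> S then flip l S else S)"
    have T: "assignment T" "l \<notin> T" "T - {- l} \<subseteq> S"
      using S assms(2) assignment_flip[OF S, of l] by (auto simp: T_def flip_def)
    obtain D where "D \<in> H" "D \<subseteq> T" using uhit_obtain[OF assms(1) T(1)] .
    with T have "D - {- l} \<in> restr l H" "D - {- l} \<subseteq> S" by (auto simp: restr_def)
    then show "\<exists>D\<in>restr l H. D \<subseteq> S" by blast
  qed
  ultimately show ?thesis using unsat_iff_covers by (simp add: uhit_def)
qed

text \<open>Deleting \<open>- l\<close> identifies no two remaining clauses: both lack
  \<open>l\<close>, so they clash in another variable, and this clash survives.\<close>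

lemma card_restr:
  assumes "uhit H"
  shows "card (restr l H) + card {C \<in> H. l \<in> C} = card H"
proof -
  have fin: "finite H" using assms by (simp add: uhit_def clause_set_def)
  have "inj_on (\<lambda>C. C - {- l}) {C \<in> H. l \<notin> C}"
  proof (rule inj_onI, rule ccontr)
    fix C D assume *: "C \<in> {C \<in> H. l \<notin> C}" "D \<in> {C \<in> H. l \<notin> C}"
      "C - {- l} = D - {- l}" "C \<noteq> D"
    then have CD: "C \<in> H" "D \<in> H" by auto
    obtain x where x: "x \<in> C" "- x \<in> D" using uhit_clash[OF assms CD *(4)] .
    have "l \<notin> C" using *(1) by simp
    with x have "- x \<in> D - {- l}" by auto
    with *(3) have "- x \<in> C" by blast
    with x(1) uhit_clause[OF assms CD(1)] show False by (auto simp: clause_def)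
  qed
  then have "card (restr l H) = card {C \<in> H. l \<notin> C}"
    unfolding restr_def by (rule card_image)
  moreover have "H = {C \<in> H. l \<notin> C} \<union> {C \<in> H. l \<in> C}" by auto
  then have "card H = card {C \<in> H. l \<notin> C} + card {C \<in> H. l \<in> C}"
    using card_Un_disjoint[of "{C \<in> H. l \<notin> C}" "{C \<in> H. l \<in> C}"] fin by auto
  ultimately show ?thesis by simp
qed

section \<open>Minimal degree and lower bound for the deficiency\<close>

text \<open>For a variable of minimal degree no other variable disappears when it is assigned:
  a lost variable would only occur in clauses containing a single literal of \<open>v\<close>.\<close>
lemma min_degree_variable:
  assumes "uhit H" "vars H \<noteq> {}"
  obtains v where "v \<in> vars H" "\<And>l. \<bar>l\<bar> = v \<Longrightarrow> vars (restr l H) = vars H - {v}"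
proof -
  define occ where "occ w = {C \<in> H. w \<in> C \<or> - w \<in> C}" for w :: int
  obtain v where v: "v \<in> vars H" "\<And>w. w \<in> vars H \<Longrightarrow> card (occ v) \<le> card (occ w)"
    using ex_has_least_nat[of "\<lambda>v. v \<in> vars H" _ "\<lambda>v. card (occ v)"] assms(2) by blast
  have "vars (restr l H) = vars H - {v}" if l: "\<bar>l\<bar> = v" for l
  proof
    show "vars (restr l H) \<subseteq> vars H - {v}"
      using l by (auto simp: vars_def restr_def abs_eq_iff)
    show "vars H - {v} \<subseteq> vars (restr l H)"
    proof
      fix w assume w: "w \<in> vars H - {v}"
      show "w \<in> vars (restr l H)"
      proof (rule ccontr)
        assume nw: "w \<notin> vars (restr l H)"
        have wpos: "\<bar>w\<bar> = w" using w by (auto simp: vars_def)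
        have sub: "l \<in> C" if C: "C \<in> occ w" for C
        proof (rule ccontr)
          assume "l \<notin> C"
          then have "C - {- l} \<in> restr l H" using C by (auto simp: restr_def occ_def)
          moreover obtain x where "x \<in> C" "\<bar>x\<bar> = w" using C wpos by (auto simp: occ_def)
          moreover have "x \<noteq> - l" using \<open>\<bar>x\<bar> = w\<close> w l by auto
          ultimately have "w \<in> vars (restr l H)" unfolding vars_def by blast
          with nw show False ..
        qed
        \<comment> \<open>Some clause contains \<open>- l\<close>, hence not \<open>l\<close>, so it
          lacks the variable \<open>w\<close>. Thus \<open>occ w\<close> is a proper subset of
          \<open>occ v\<close>, against minimality.\<close>
        have "\<bar>- l\<bar> \<in> vars H" using l v by simp
        then obtain D where D: "D \<in> H" "- l \<in> D" by (rule var_literal_occurs[OF assms(1)])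
        have "D \<in> occ v" using D l by (auto simp: occ_def abs_if split: if_splits)
        moreover have "D \<notin> occ w" using D sub uhit_clause[OF assms(1) D(1)] by (auto simp: clause_def)
        moreover have "occ w \<subseteq> occ v" using sub l by (auto simp: occ_def abs_if split: if_splits)
        moreover have "finite (occ v)" using assms by (simp add: occ_def uhit_def clause_set_def)
        ultimately have "card (occ w) < card (occ v)" by (intro psubset_card_mono) auto
        with v(2)[of w] w show False by simp
      qed
    qed
  qed
  with v that show ?thesis by blast
qed

lemma deficiency_restr:
  assumes "uhit H" "\<bar>l\<bar> \<in> vars H" "vars (restr l H) = vars H - {\<bar>l\<bar>}"
  shows "deficiency (restr l H) = deficiency H + 1 - int (card {C \<in> H. l \<in> C})"
proof -
  have "finite (vars H)" using assms finite_vars by (simp add: uhit_def)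
  then have "card (vars H) = Suc (card (vars (restr l H)))"
    using assms(2,3) card.remove by metis
  with card_restr[OF assms(1), of l] show ?thesis unfolding deficiency_def by linarith
qed

lemma zero_notin_vars: "uhit H \<Longrightarrow> 0 \<notin> vars H"
  by (auto simp: vars_def uhit_def clause_set_def clause_def)

text \<open>Assigning a variable of minimal degree costs exactly one variable and at least one
  clause, so the deficiency does not increase and induction on the number of variables
  applies.\<close>

lemma deficiency_ge_1: "uhit H \<Longrightarrow> deficiency H \<ge> 1"
proof (induction "card (vars H)" arbitrary: H rule: less_induct)
  case less
  have fin: "finite (vars H)" "finite H"
    using less.prems finite_vars by (auto simp: uhit_def clause_set_def)
  show ?case
  proof (cases "vars H = {}")
    case True
    have "H \<noteq> {}"
      using less.prems unfolding uhit_def satisfiable_def by (auto simp: clause_def)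
    with fin have "card H \<ge> 1" by (simp add: Suc_leI card_gt_0_iff)
    with True show ?thesis by (simp add: deficiency_def)
  next
    case False
    then obtain v where v: "v \<in> vars H" "\<And>l. \<bar>l\<bar> = v \<Longrightarrow> vars (restr l H) = vars H - {v}"
      using min_degree_variable less.prems by metis
    have va: "\<bar>v\<bar> = v" using v(1) by (auto simp: vars_def)
    have u: "uhit (restr v H)" using uhit_restr less.prems v(1) zero_notin_vars by metis
    have "card (vars (restr v H)) < card (vars H)"
      using v(2)[OF va] v(1) fin by (metis card_Diff1_less)
    then have "deficiency (restr v H) \<ge> 1" using less.hyps u by blast
    moreover obtain D where "D \<in> H" "v \<in> D" using var_literal_occurs less.prems v(1) va by metis
    then have "card {C \<in> H. v \<in> C} \<noteq> 0" using fin by auto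
    ultimately show ?thesis
      using deficiency_restr[OF less.prems, of v] v(1) v(2)[OF va] va by simp
  qed
qed

text \<open>The upper bound on the occurrences of \<open>l\<close> is the inequality
  \<open>deficiency_ge_1\<close> for \<open>restr l H\<close>.\<close>

lemma low_degree_variable:
  assumes "uhit H" "vars H \<noteq> {}"
  obtains v where "v \<in> vars H" "v \<noteq> 0"
    "\<And>l. \<bar>l\<bar> = v \<Longrightarrow> deficiency (restr l H) = deficiency H + 1 - int (card {C \<in> H. l \<in> C})"
    "\<And>l. \<bar>l\<bar> = v \<Longrightarrow> card (vars (restr l H)) < card (vars H)"
    "\<And>l. \<bar>l\<bar> = v \<Longrightarrow> 1 \<le> card {C \<in> H. l \<in> C} \<and> int (card {C \<in> H. l \<in> C}) \<le> deficiency H"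
proof -
  obtain v where v: "v \<in> vars H" "\<And>l. \<bar>l\<bar> = v \<Longrightarrow> vars (restr l H) = vars H - {v}"
    using min_degree_variable assms by metis
  have fin: "finite (vars H)" "finite H"
    using assms finite_vars by (auto simp: uhit_def clause_set_def)
  have v0: "v \<noteq> 0" using v(1) zero_notin_vars[OF assms(1)] by auto
  have *: "deficiency (restr l H) = deficiency H + 1 - int (card {C \<in> H. l \<in> C})" if "\<bar>l\<bar> = v" for l
    using deficiency_restr[OF assms(1), of l] that v by simp
  moreover have "card (vars (restr l H)) < card (vars H)" if "\<bar>l\<bar> = v" for l
    using v(2)[OF that] v(1) fin by (metis card_Diff1_less)
  moreover have "1 \<le> card {C \<in> H. l \<in> C} \<and> int (card {C \<in> H. l \<in> C}) \<le> deficiency H"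
    if l: "\<bar>l\<bar> = v" for l
  proof
    obtain D where "D \<in> H" "l \<in> D" using var_literal_occurs[OF assms(1)] v(1) l by metis
    then have "card {C \<in> H. l \<in> C} \<noteq> 0" using fin by auto
    then show "1 \<le> card {C \<in> H. l \<in> C}" by simp
    have "uhit (restr l H)" using uhit_restr assms l v0 by auto
    from deficiency_ge_1[OF this] *[OF l] show "int (card {C \<in> H. l \<in> C}) \<le> deficiency H" by simp
  qed
  ultimately show ?thesis using that v v0 by blast
qed

section \<open>Literals occurring once, and deficiency 1\<close>

text \<open>Flipping a point of the subcube of \<open>Q\<close> leads into a clause containing
  \<open>v\<close>, which can only be \<open>P\<close>; so \<open>P - {v}\<close> is falsified on
  all of \<open>Q\<close>.\<close>

lemma unique_occurrence_subset:
  assumes "uhit H" "\<And>D. D \<in> H \<Longrightarrow> v \<in> D \<Longrightarrow> D = P" "P \<in> H" "Q \<in> H" "- v \<in> Q"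
  shows "P - {v} \<subseteq> Q"
proof (rule subset_if_all_assignments)
  show "clause Q" "clause (P - {v})"
    using assms uhit_clause clause_subset[of P] by auto
  fix S assume S: "assignment S" "Q \<subseteq> S"
  obtain D where "D \<in> H" "- (- v) \<in> D" "D \<subseteq> flip (- v) S"
    using flip_falsified[OF assms(1) S(1) assms(4) S(2) assms(5)] .
  with assms(2)[of D] show "P - {v} \<subseteq> S" by (auto simp: flip_def)
qed

text \<open>Hitting clause-sets of deficiency 1 arise from \<open>{{}}\<close> by repeatedly splitting a clause on a
  fresh variable, i.e. they are the leaves of a decision tree with distinct variables. If
  \<open>x y R\<close> and \<open>-x R\<close> are leaves, then \<open>x\<close> is decided at \<open>R\<close> and
  \<open>y\<close> right below it, so \<open>x, -y, R\<close> is a node of the tree.\<close>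
lemma deficiency_1_node:
  assumes "uhit H" "deficiency H = 1" "insert x (insert y R) \<in> H" "insert (- x) R \<in> H"
    "y \<notin> R" "y \<noteq> x" "E \<in> H"
  shows "(\<exists>z\<in>E. - z \<in> insert x (insert (- y) R)) \<or> insert x (insert (- y) R) \<subseteq> E"
  using assms
proof (induction "card (vars H)" arbitrary: H E rule: less_induct)
  case less
  note u = less.prems(1)
  let ?X = "insert x (insert y R)" and ?Y = "insert (- x) R"
  have "\<bar>x\<bar> \<in> vars H" using less.prems(3) by (force simp: vars_def)
  then have ne: "vars H \<noteq> {}" by auto
  have cl: "clause ?X" "clause ?Y" using less.prems uhit_clause by auto
  obtain v where v: "v \<in> vars H" "v \<noteq> 0"
    "\<And>l. \<bar>l\<bar> = v \<Longrightarrow> deficiency (restr l H) = deficiency H + 1 - int (card {C \<in> H. l \<in> C})"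
    "\<And>l. \<bar>l\<bar> = v \<Longrightarrow> card (vars (restr l H)) < card (vars H)"
    "\<And>l. \<bar>l\<bar> = v \<Longrightarrow> 1 \<le> card {C \<in> H. l \<in> C} \<and> int (card {C \<in> H. l \<in> C}) \<le> deficiency H"
    using low_degree_variable[OF u ne] by blast
  have c1: "card {C \<in> H. l \<in> C} = 1" if "\<bar>l\<bar> = v" for l
    using v(5)[OF that] less.prems(2) by simp
  have ex1: "\<exists>P\<in>H. l \<in> P \<and> (\<forall>D\<in>H. l \<in> D \<longrightarrow> D = P)" if "\<bar>l\<bar> = v" for l
  proof -
    obtain P where "{C \<in> H. l \<in> C} = {P}" using c1 \<open>\<bar>l\<bar> = v\<close> by (auto simp: card_1_singleton_iff)
    then show ?thesis by blast
  qed
  \<comment> \<open>Both literals of \<open>v\<close> occur exactly once, so their two clauses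
    include each other up to \<open>v\<close>: they are siblings in the tree.\<close>
  have pair: "insert (- l) (P - {l}) \<in> H" if "\<bar>l\<bar> = v" "P \<in> H" "l \<in> P" for l P
  proof -
    have nl: "\<bar>- l\<bar> = v" using that by simp
    obtain Q where Q: "Q \<in> H" "- l \<in> Q" "\<forall>D\<in>H. - l \<in> D \<longrightarrow> D = Q" using ex1[OF nl] by blast
    have P: "\<forall>D\<in>H. l \<in> D \<longrightarrow> D = P" using ex1[OF that(1)] that by blast
    have "P - {l} \<subseteq> Q" using unique_occurrence_subset[OF u, of l P Q] P that Q by blast
    moreover have "Q - {- l} \<subseteq> P"
      using unique_occurrence_subset[OF u, of "- l" Q P] that Q by (metis minus_minus)
    moreover have "l \<notin> Q" using uhit_clause[OF u Q(1)] Q(2) by (auto simp: clause_def)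
    ultimately have "insert (- l) (P - {l}) = Q" using Q(2) by blast
    with Q(1) show ?thesis by metis
  qed
  have uniq: "D = P" if "\<bar>l\<bar> = v" "P \<in> H" "l \<in> P" "D \<in> H" "l \<in> D" for l P D
    using ex1[OF that(1)] that by blast
  show ?case
  proof (cases "\<exists>l\<in>?X. \<bar>l\<bar> = v")
    case True
    then obtain l where l: "l \<in> ?X" "\<bar>l\<bar> = v" by blast
    consider "l = x" | "l = y" | "l \<in> R" using l by auto
    then show ?thesis
    proof cases
      \<comment> \<open>The sibling of \<open>?X\<close> over \<open>x\<close> would have to be
        \<open>?Y\<close>, yet it contains \<open>y\<close>.\<close>
      case 1
      have "insert (- x) (?X - {x}) = ?Y"
        using uniq[of "- x" ?Y "insert (- x) (?X - {x})"] pair[of x ?X] less.prems 1 l by auto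
      moreover have "y \<noteq> - x" using cl(1) by (auto simp: clause_def)
      ultimately have False using less.prems(5,6) by auto
      then show ?thesis ..
    next
      \<comment> \<open>Here the node is itself a clause, so \<open>E\<close> equals it or clashes
        with it.\<close>
      case 2
      have "insert (- y) (?X - {y}) \<in> H" using pair[of y ?X] less.prems 2 l by auto
      moreover have "insert (- y) (?X - {y}) = insert x (insert (- y) R)"
        using less.prems by auto
      ultimately have "insert x (insert (- y) R) \<in> H" by simp
      then show ?thesis
        using uhit_clash[OF u less.prems(7), of "insert x (insert (- y) R)"]
        by (cases "E = insert x (insert (- y) R)") (simp, metis)
    next
      case 3
      then have "?Y = ?X" using uniq[of l ?X ?Y] less.prems l by auto
      then have "x \<in> ?Y" "- x \<in> ?Y" by auto
      then have False using cl(2) unfolding clause_def by blast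
      then show ?thesis ..
    qed
  next
    case False
    define H0 where "H0 = restr v H"
    have va: "\<bar>v\<bar> = v" using v(1) by (auto simp: vars_def)
    have H0: "uhit H0" "deficiency H0 = 1" "card (vars H0) < card (vars H)"
      using uhit_restr[OF u v(2)] v(3,4)[OF va] c1[OF va] less.prems(2) by (auto simp: H0_def)
    have Y: "\<bar>l\<bar> \<noteq> v" if "l \<in> ?Y" for l using False that by auto
    have "?X - {- v} \<in> H0" using False less.prems va unfolding H0_def restr_def by blast
    moreover have "- v \<notin> ?X" using False va by (metis abs_minus_cancel)
    ultimately have X0: "?X \<in> H0" by (metis Diff_insert_absorb Diff_empty Diff_insert0)
    have "?Y - {- v} \<in> H0" using Y less.prems va unfolding H0_def restr_def by blast
    moreover have "- v \<notin> ?Y" using Y va by (metis abs_minus_cancel)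
    ultimately have Y0: "?Y \<in> H0" by (metis Diff_insert_absorb Diff_empty Diff_insert0)
    \<comment> \<open>If \<open>E\<close> contains \<open>v\<close> it disappears in
      \<open>H0\<close>, but its sibling leaves behind \<open>E - {v}\<close>.\<close>
    obtain E0 where E0: "E0 \<in> H0" "E0 \<subseteq> E"
    proof (cases "v \<in> E")
      case True
      let ?Q = "insert (- v) (E - {v})"
      have "?Q \<in> H" using pair[OF va] less.prems True by blast
      moreover have "v \<notin> ?Q" using v(2) by auto
      ultimately have "?Q - {- v} \<in> H0" unfolding H0_def restr_def by blast
      then show ?thesis using that by blast
    next
      case False
      then have "E - {- v} \<in> H0" using less.prems unfolding H0_def restr_def by blast
      then show ?thesis using that by blast
    qed
    from less.hyps[OF H0(3,1,2) X0 Y0 less.prems(5,6) E0(1)] E0(2) show ?thesis by blast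
  qed
qed

section \<open>Consequences of clause-irreducibility\<close>

text \<open>Such a \<open>K\<close> has intersection \<open>C\<close> and is a clause-factor, so it
  must be trivial. Irreducibility enters the later arguments in this form.\<close>

lemma irreducible_covered_cube:
  assumes "clause_set F" "clause_irreducible F" "K \<subseteq> F" "clause C"
    "\<And>D. D \<in> K \<Longrightarrow> C \<subseteq> D" "covers K C"
  shows "K = {C} \<or> K = F \<and> C = {}"
proof -
  have csK: "clause_set K" using clause_set_subset assms by blast
  have clK: "clause D" if "D \<in> K" for D using that csK by (auto simp: clause_set_def)
  obtain S0 where "assignment S0" "C \<subseteq> S0" using assms(4) by (rule clause_extends_assignment)
  then have ne: "K \<noteq> {}" using assms(6) unfolding covers_def by blast
  have Int: "\<Inter> K = C"
  proof
    show "\<Inter> K \<subseteq> C"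
    proof (rule subset_if_all_assignments[OF assms(4)])
      show "clause (\<Inter> K)" using ne clK clause_subset by (metis Inter_lower equals0I)
      show "\<Inter> K \<subseteq> S" if "assignment S" "C \<subseteq> S" for S
        using assms(6) that unfolding covers_def by (meson Inter_lower subset_trans)
    qed
  qed (use assms(5) in blast)
  let ?K = "{D - \<Inter> K | D. D \<in> K}"
  have "?K = (\<lambda>D. D - \<Inter> K) ` K" by auto
  then have "clause_set ?K" using csK clause_subset by (auto simp: clause_set_def)
  moreover have "covers ?K {}"
    unfolding covers_def
  proof (intro allI impI)
    fix S :: "literal set" assume "assignment S \<and> {} \<subseteq> S"
    then have S: "assignment S" by simp
    \<comment> \<open>\<open>S\<close> is changed on the variables of \<open>C\<close> only, so as
      to falsify \<open>C\<close>.\<close>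
    let ?S = "(S - uminus ` C) \<union> C"
    have neg: "x \<in> uminus ` C \<longleftrightarrow> - x \<in> C" for x
      by force
    have "assignment ?S"
      using S assms(4) unfolding assignment_def clause_def Un_iff Diff_iff neg by (auto simp: neg)
    then obtain D where D: "D \<in> K" "D \<subseteq> ?S" using assms(6) unfolding covers_def by blast
    then have "D - \<Inter> K \<in> ?K" "D - \<Inter> K \<subseteq> S" using Int by auto
    then show "\<exists>D\<in>?K. D \<subseteq> S" by blast
  qed
  ultimately have "unsatisfiable ?K" using unsat_iff_covers by blast
  then have "trivial_factor K F"
    using assms(2,3) ne csK unfolding clause_irreducible_def clause_factor_of_def clause_factor_def by blast
  then consider "card K = 1" | "unsatisfiable K" "K = F" unfolding trivial_factor_def by blast
  then show ?thesis
  proof cases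
    case 1
    then obtain D where "K = {D}" by (auto simp: card_1_singleton_iff)
    with Int show ?thesis by simp
  next
    case 2
    have "C = {}"
    proof (rule ccontr)
      assume "C \<noteq> {}"
      then obtain x where x: "x \<in> C" by blast
      have "clause {x}" using x assms(4) by (auto intro: clause_subset)
      moreover have "\<forall>D\<in>K. {x} \<inter> D \<noteq> {}" using x assms(5) by auto
      ultimately show False using 2 unfolding satisfiable_def by blast
    qed
    with 2 show ?thesis by simp
  qed
qed

text \<open>If \<open>v\<close> occurs only in \<open>P\<close>, then \<open>P\<close> and the
  clauses with \<open>- v\<close> form a clause-factor covering \<open>P - {v}\<close>. Triviality
  gives \<open>P = {v}\<close>; then the clauses with \<open>- v\<close> form a factor too, leaving
  only \<open>{{v}, {- v}}\<close>, of deficiency 1.\<close>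

lemma irreducible_not_singular:
  assumes "uhit F" "clause_irreducible F" "deficiency F \<noteq> 1" "v \<noteq> 0"
  shows "card {C \<in> F. v \<in> C} \<noteq> 1"
proof
  assume "card {C \<in> F. v \<in> C} = 1"
  then obtain P where "{C \<in> F. v \<in> C} = {P}" by (auto simp: card_1_singleton_iff)
  then have P: "P \<in> F" "v \<in> P" "\<And>D. D \<in> F \<Longrightarrow> v \<in> D \<Longrightarrow> D = P" by blast+
  have cs: "clause_set F" using assms by (simp add: uhit_def)
  let ?N = "{D \<in> F. - v \<in> D}"
  have "insert P ?N = {P - {v}} \<or> insert P ?N = F \<and> P - {v} = {}"
  proof (rule irreducible_covered_cube[OF cs assms(2)])
    show "clause (P - {v})" using uhit_clause[OF assms(1) P(1)] by (auto intro: clause_subset)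
    show "P - {v} \<subseteq> D" if "D \<in> insert P ?N" for D
      using that unique_occurrence_subset[OF assms(1) P(3) P(1), of v D] by auto
    show "covers (insert P ?N) (P - {v})"
      unfolding covers_def
    proof (intro allI impI)
      fix S assume S: "assignment S \<and> P - {v} \<subseteq> S"
      show "\<exists>D\<in>insert P ?N. D \<subseteq> S"
      proof (cases "v \<in> S")
        case True
        then show ?thesis using S by blast
      next
        case False
        \<comment> \<open>The point is moved to where \<open>P\<close> is falsified; flipping back
          yields a clause with \<open>- v\<close> at the original point.\<close>
        then have "- v \<in> S" using S assms(4) by (auto simp: assignment_def)
        then have T: "assignment (flip (- v) S)" "P \<subseteq> flip (- v) S"
          using S assignment_flip[of S "- v"] uhit_clause[OF assms(1) P(1)] P(2)
          by (auto simp: flip_def clause_def)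
        obtain D where D: "D \<in> F" "- v \<in> D" "D \<subseteq> flip v (flip (- v) S)"
          using flip_falsified[OF assms(1) T(1) P(1) T(2) P(2)] .
        then have "D \<subseteq> S" using \<open>- v \<in> S\<close> by (auto simp: flip_def)
        with D show ?thesis by blast
      qed
    qed
    show "insert P ?N \<subseteq> F" using P(1) by blast
  qed
  moreover have "P \<noteq> P - {v}" using P(2) by blast
  ultimately have F: "insert P ?N = F" and Pv: "P = {v}" using P(2) by blast+
  have "?N = {{- v}} \<or> ?N = F \<and> {- v} = {}"
  proof (rule irreducible_covered_cube[OF cs assms(2)])
    show "clause {- v}" using assms(4) by (auto simp: clause_def)
    show "covers ?N {- v}"
      unfolding covers_def
    proof (intro allI impI)
      fix S assume S: "assignment S \<and> {- v} \<subseteq> S"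
      then obtain D where D: "D \<in> F" "D \<subseteq> S" using uhit_obtain[OF assms(1)] by blast
      have "v \<notin> S" using S assms(4) by (auto simp: assignment_def)
      then have "D \<noteq> P" using D Pv by auto
      with D F show "\<exists>D\<in>?N. D \<subseteq> S" by blast
    qed
  qed auto
  then have "F = {{v}, {- v}}" using F Pv by auto
  moreover have "{v} \<noteq> {- v}" using assms(4) by auto
  ultimately have "deficiency F = 1" by (simp add: deficiency_def vars_def)
  with assms(3) show False ..
qed

section \<open>Two pairs of disjoint subcubes with the same union\<close>

text \<open>Were there a further literal \<open>y\<close> in \<open>B1\<close>, a point of
  \<open>A\<close> falsifying \<open>x\<close> and \<open>- y\<close> would lie in neither part.
  Hence the parts are the two halves of \<open>A\<close>.\<close>

lemma cube_split:
  assumes "clause B1" "clause B2" "A \<subseteq> B1" "A \<subseteq> B2" "x \<in> B1" "- x \<in> B2"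
    "\<And>S. assignment S \<Longrightarrow> A \<subseteq> S \<Longrightarrow> B1 \<subseteq> S \<or> B2 \<subseteq> S"
  shows "B1 = insert x A" "B2 = insert (- x) A"
proof -
  have half: "B1 \<subseteq> insert x A"
    if "clause B1" "clause B2" "A \<subseteq> B1" "A \<subseteq> B2" "x \<in> B1" "- x \<in> B2"
      "\<And>S. assignment S \<Longrightarrow> A \<subseteq> S \<Longrightarrow> B1 \<subseteq> S \<or> B2 \<subseteq> S" for B1 B2 x
  proof
    fix y assume y: "y \<in> B1"
    show "y \<in> insert x A"
    proof (rule ccontr)
      assume n: "y \<notin> insert x A"
      have "clause (insert (- y) (insert x A))"
        using that n y by (auto simp: clause_insert clause_def finite_subset)
      then obtain S where S: "assignment S" "insert (- y) (insert x A) \<subseteq> S"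
        by (rule clause_extends_assignment)
      then have "B1 \<subseteq> S \<or> B2 \<subseteq> S" using that(7) by blast
      with S y that(5,6) assignment_consistent show False by blast
    qed
  qed
  show "B1 = insert x A" using half[of B1 B2 x] assms by blast
  show "B2 = insert (- x) A" using half[of B2 B1 "- x"] assms
    by (metis insert_subset minus_minus subset_antisym)
qed

lemma not_clash_clause_Un:
  assumes "clause A" "clause B" "\<not> (\<exists>x\<in>A. - x \<in> B)" shows "clause (A \<union> B)"
  using assms unfolding clause_def by (metis Un_iff finite_Un minus_minus)

text \<open>Each subcube of one pair meets both of the other, so it is halved by them: along
  \<open>x\<close> for the \<open>A\<close>s, along \<open>z\<close> for the \<open>B\<close>s.
  Comparing the intersections shows that \<open>A1\<close> and \<open>A2\<close> differ only in
  \<open>z\<close>.\<close>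

lemma cubes_all_compatible:
  assumes cl: "clause A1" "clause A2" "clause B1" "clause B2"
    and hit: "z \<in> A1" "- z \<in> A2" "x \<in> B1" "- x \<in> B2"
    and AB: "\<forall>S. assignment S \<longrightarrow> (A1 \<subseteq> S \<or> A2 \<subseteq> S \<longleftrightarrow> B1 \<subseteq> S \<or> B2 \<subseteq> S)"
    and nc: "clause (A1 \<union> B1)" "clause (A1 \<union> B2)" "clause (A2 \<union> B1)" "clause (A2 \<union> B2)"
  shows "\<exists>R. A1 = insert z R \<and> A2 = insert (- z) R"
proof -
  have a1: "A1 \<union> B1 = insert x A1" "A1 \<union> B2 = insert (- x) A1"
    by (rule cube_split[of "A1 \<union> B1" "A1 \<union> B2" A1 x]; use nc hit AB in blast)+
  have a2: "A2 \<union> B1 = insert x A2" "A2 \<union> B2 = insert (- x) A2"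
    by (rule cube_split[of "A2 \<union> B1" "A2 \<union> B2" A2 x]; use nc hit AB in blast)+
  have b1: "A1 \<union> B1 = insert z B1" "A2 \<union> B1 = insert (- z) B1"
    by (rule cube_split[of "A1 \<union> B1" "A2 \<union> B1" B1 z]; use nc hit AB in blast)+
  have b2: "A1 \<union> B2 = insert z B2" "A2 \<union> B2 = insert (- z) B2"
    by (rule cube_split[of "A1 \<union> B2" "A2 \<union> B2" B2 z]; use nc hit AB in blast)+
  have nx: "x \<notin> A1" "x \<notin> A2" "- x \<notin> A1" "- x \<notin> A2"
    using nc hit unfolding clause_def by (metis UnI1 UnI2 minus_minus)+
  have nz: "z \<notin> A2" "- z \<notin> A1" using cl hit unfolding clause_def by (metis minus_minus)+
  have "A1 - {z} \<subseteq> B1 - {x}" "A2 - {- z} \<subseteq> B1 - {x}" using b1 nx by blast+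
  moreover have "B1 - {x} \<subseteq> A1" "B1 - {x} \<subseteq> A2" using a1 a2 by blast+
  ultimately have "A1 - {z} = A2 - {- z}" using nz by blast
  then have "A1 = insert z (A1 - {z}) \<and> A2 = insert (- z) (A1 - {z})" using hit by blast
  then show ?thesis ..
qed

text \<open>Subcube \<open>A1\<close> avoids \<open>B1\<close>, so it lies inside \<open>B2\<close>;
  likewise \<open>B1\<close> lies inside \<open>A2\<close>. The rest of \<open>A2\<close> and of
  \<open>B2\<close> is their common part, so \<open>cube_split\<close> applies to both, and
  \<open>R\<close> is \<open>A2 \<inter> B2\<close>.\<close>

lemma cubes_incompatible:
  assumes cl: "clause A1" "clause A2" "clause B1" "clause B2"
    and hit: "z \<in> A1" "- z \<in> A2" "x \<in> B1" "- x \<in> B2"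
    and AB: "\<forall>S. assignment S \<longrightarrow> (A1 \<subseteq> S \<or> A2 \<subseteq> S \<longleftrightarrow> B1 \<subseteq> S \<or> B2 \<subseteq> S)"
    and inc: "w \<in> A1" "- w \<in> B1" and ne: "A2 \<noteq> B1"
  shows "\<exists>R x y. A1 = insert y (insert (- x) R) \<and> A2 = insert (- y) R \<and>
    B1 = insert x (insert (- y) R) \<and> B2 = insert (- x) R \<and>
    y \<notin> R \<and> x \<notin> R \<and> - x \<notin> R \<and> - y \<notin> R \<and> x \<noteq> y \<and> x \<noteq> - y"
proof -
  have sub: "B2 \<subseteq> A1" "A2 \<subseteq> B1"
  proof -
    show "B2 \<subseteq> A1"
      by (rule subset_if_all_assignments[OF cl(1,4)]) (use AB inc assignment_consistent in blast)
    show "A2 \<subseteq> B1"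
      by (rule subset_if_all_assignments[OF cl(3,2)]) (use AB inc assignment_consistent in blast)
  qed
  have com: "clause (A2 \<union> B2)"
  proof (rule ccontr)
    assume "\<not> clause (A2 \<union> B2)"
    then obtain u where u: "u \<in> A2" "- u \<in> B2" using not_clash_clause_Un cl by blast
    have "B1 \<subseteq> A2"
      by (rule subset_if_all_assignments[OF cl(2,3)]) (use AB u assignment_consistent in blast)
    with sub ne show False by blast
  qed
  have s1: "A1 = insert z B2" "A2 \<union> B2 = insert (- z) B2"
    by (rule cube_split[of A1 "A2 \<union> B2" B2 z]; use cl com sub hit AB in blast)+
  have s2: "B1 = insert x A2" "A2 \<union> B2 = insert (- x) A2"
    by (rule cube_split[of B1 "A2 \<union> B2" A2 x]; use cl com sub hit AB in blast)+
  have nz: "z \<notin> A2" "z \<notin> B2" "- z \<notin> A1" using com cl hit unfolding clause_def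
    by (metis UnI1 UnI2 minus_minus)+
  have nx: "x \<notin> A2" "x \<notin> B2" "- x \<notin> B1" using com cl hit unfolding clause_def
    by (metis UnI1 UnI2 minus_minus)+
  let ?R = "A2 \<inter> B2"
  have "- z \<notin> B2" "- x \<notin> A2" using nz nx sub by auto
  have R: "A2 = insert (- z) ?R" "B2 = insert (- x) ?R" using s1 s2 hit by blast+
  have A1: "A1 = insert z (insert (- x) ?R)" using s1(1) R(2) by metis
  have B1: "B1 = insert x (insert (- z) ?R)" using s2(1) R(1) by metis
  have "x \<noteq> z" using sub(2) nx(3) hit(2) by auto
  moreover have "x \<noteq> - z" using nx hit by auto
  ultimately show ?thesis using nz nx \<open>- z \<notin> B2\<close> \<open>- x \<notin> A2\<close>
    by (intro exI[of _ ?R] exI[of _ x] exI[of _ z] conjI A1 B1 R) simp_all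
qed

section \<open>Structure of irreducible clause-sets of deficiency 2\<close>

lemma flip_covered:
  assumes "uhit F" "v \<noteq> 0" "assignment S" "C \<in> F" "v \<in> C" "C - {v} \<subseteq> S"
  shows "\<exists>D\<in>F. - v \<in> D \<and> D - {- v} \<subseteq> S"
proof -
  define T where "T = (if v \<in> S then S else flip (- v) S)"
  have "- v \<in> S" if "v \<notin> S" using that assms(2,3) by (auto simp: assignment_def)
  then have T: "assignment T" "C \<subseteq> T" "T - {v} \<subseteq> S"
    using assms assignment_flip[OF assms(3), of "- v"] uhit_clause[OF assms(1,4)]
    by (auto simp: T_def flip_def clause_def)
  obtain D where "D \<in> F" "- v \<in> D" "D \<subseteq> flip v T"
    using flip_falsified[OF assms(1) T(1) assms(4) T(2) assms(5)] .
  with T(3) show ?thesis by (intro bexI[of _ D]) (auto simp: flip_def)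
qed

text \<open>The binary clauses are the implications from \<open>a\<close> to \<open>b\<close> to
  \<open>c\<close> to \<open>a\<close>, forcing equal values; the ternary ones exclude both equal
  values.\<close>

definition cyc :: "literal \<Rightarrow> literal \<Rightarrow> literal \<Rightarrow> literal set set" where
  "cyc a b c = {{a, b, c}, {- a, - b, - c}, {- a, b}, {- b, c}, {- c, a}}"

text \<open>This treats a clash between \<open>C1\<close> and \<open>D1\<close>; other clashes
  between the pairs reduce to it by swapping within a pair.\<close>

lemma irreducible_clash_is_cyc:
  assumes u: "uhit F" and irr: "clause_irreducible F" and v0: "v \<noteq> 0"
    and C: "{C \<in> F. v \<in> C} = {C1, C2}" "C1 \<noteq> C2"
    and D: "{C \<in> F. - v \<in> C} = {D1, D2}" "D1 \<noteq> D2"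
    and def1: "deficiency (restr (- v) F) = 1"
    and AB: "\<forall>S. assignment S \<longrightarrow>
      (C1 - {v} \<subseteq> S \<or> C2 - {v} \<subseteq> S \<longleftrightarrow> D1 - {- v} \<subseteq> S \<or> D2 - {- v} \<subseteq> S)"
    and hitC: "z \<in> C1 - {v}" "- z \<in> C2 - {v}"
    and hitD: "x0 \<in> D1 - {- v}" "- x0 \<in> D2 - {- v}"
    and w: "w \<in> C1 - {v}" "- w \<in> D1 - {- v}"
  shows "\<exists>a b c. F = cyc a b c \<and> a \<noteq> 0 \<and> b \<noteq> 0 \<and> c \<noteq> 0 \<and>
    a \<noteq> b \<and> a \<noteq> - b \<and> a \<noteq> c \<and> a \<noteq> - c \<and> b \<noteq> c \<and> b \<noteq> - c"
proof -
  have cs: "clause_set F" using u by (simp add: uhit_def)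
  have CF: "C1 \<in> F" "v \<in> C1" "C2 \<in> F" "v \<in> C2" using C(1) by blast+
  have DF: "D1 \<in> F" "- v \<in> D1" "D2 \<in> F" "- v \<in> D2" using D(1) by blast+
  have cl: "clause C1" "clause C2" "clause D1" "clause D2" using uhit_clause[OF u] CF DF by auto
  have nv: "- v \<notin> C1" "- v \<notin> C2" "v \<notin> D1" "v \<notin> D2"
    using cl CF DF unfolding clause_def by (metis minus_minus)+
  have clAB: "clause (C1 - {v})" "clause (C2 - {v})" "clause (D1 - {- v})" "clause (D2 - {- v})"
    using cl clause_subset by blast+
  \<comment> \<open>Otherwise \<open>C2\<close> and \<open>D1\<close> would be the two halves of a
    subcube along \<open>v\<close>, a nontrivial clause-factor.\<close>
  have ne: "C2 - {v} \<noteq> D1 - {- v}"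
  proof
    assume eq: "C2 - {v} = D1 - {- v}"
    have "{C2, D1} = {C2 - {v}} \<or> {C2, D1} = F \<and> C2 - {v} = {}"
    proof (rule irreducible_covered_cube[OF cs irr])
      show "C2 - {v} \<subseteq> E" if "E \<in> {C2, D1}" for E using that eq by auto
      show "covers {C2, D1} (C2 - {v})"
        unfolding covers_def
      proof (intro allI impI)
        fix S assume S: "assignment S \<and> C2 - {v} \<subseteq> S"
        then have "v \<in> S \<or> - v \<in> S" using v0 by (auto simp: assignment_def)
        moreover have "C2 \<subseteq> insert v (C2 - {v})" "D1 \<subseteq> insert (- v) (C2 - {v})"
          by (blast, unfold eq, blast)
        ultimately have "C2 \<subseteq> S \<or> D1 \<subseteq> S" using S by (meson insert_subset subset_trans)
        then show "\<exists>D\<in>{C2, D1}. D \<subseteq> S" by blast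
      qed
      show "{C2, D1} \<subseteq> F" using CF DF by blast
    qed (rule clAB)
    moreover have "C2 \<noteq> C2 - {v}" using CF by blast
    moreover have "C1 \<noteq> D1" using CF nv by blast
    ultimately show False using CF(1) C(2) by blast
  qed
  obtain R x y where R: "C1 - {v} = insert y (insert (- x) R)" "C2 - {v} = insert (- y) R"
    "D1 - {- v} = insert x (insert (- y) R)" "D2 - {- v} = insert (- x) R"
    and nR: "y \<notin> R" "x \<notin> R" "- x \<notin> R" "- y \<notin> R" "x \<noteq> y" "x \<noteq> - y"
    using cubes_incompatible[OF clAB hitC hitD AB w ne] by (elim exE conjE) (rule that)
  have Ceq: "C1 = insert v (insert y (insert (- x) R))" "C2 = insert v (insert (- y) R)"
    "D1 = insert (- v) (insert x (insert (- y) R))" "D2 = insert (- v) (insert (- x) R)"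
    using R CF DF by (metis insert_Diff)+
  have clR: "clause R" "x \<noteq> 0" "y \<noteq> 0"
    using cl(1) unfolding Ceq clause_insert by auto
  have nvy: "v \<notin> R" "v \<noteq> y" "v \<noteq> - x" "v \<noteq> x" "v \<noteq> - y" "y \<noteq> - x"
  proof -
    have "v \<notin> insert y (insert (- x) R)" using R(1) by blast
    then show "v \<notin> R" "v \<noteq> y" "v \<noteq> - x" by auto
    have "- v \<notin> insert y (insert (- x) R)" using nv(1) Ceq(1) by blast
    then show "v \<noteq> x" "v \<noteq> - y" by auto
    show "y \<noteq> - x" using nR by auto
  qed
  \<comment> \<open>\<open>?E\<close> is the part of the subcube of \<open>R\<close> that the four
    clauses leave uncovered.\<close>
  let ?E = "insert y (insert x R)"
  have clE: "clause ?E" using clR nR nvy by (auto simp: clause_insert)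
  have "- v \<noteq> 0" using v0 by simp
  have uH: "uhit (restr (- v) F)" by (rule uhit_restr[OF u \<open>- v \<noteq> 0\<close>])
  have inH: "E - {v} \<in> restr (- v) F" if "E \<in> F" "- v \<notin> E" for E
    using that unfolding restr_def by auto
  have H: "insert y (insert (- x) R) \<in> restr (- v) F" "insert (- y) R \<in> restr (- v) F"
    using inH[OF CF(1) nv(1)] inH[OF CF(3) nv(2)] R by auto
  have "{E \<in> F. ?E \<subseteq> E} = {?E} \<or> {E \<in> F. ?E \<subseteq> E} = F \<and> ?E = {}"
  proof (rule irreducible_covered_cube[OF cs irr])
    show "covers {E \<in> F. ?E \<subseteq> E} ?E"
      unfolding covers_def
    proof (intro allI impI)
      fix S assume S: "assignment S \<and> ?E \<subseteq> S"
      then obtain E where E: "E \<in> F" "E \<subseteq> S" using uhit_obtain[OF u] by blast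
      have nS: "- x \<notin> S" "- y \<notin> S" using S assignment_consistent by blast+
      have "E \<noteq> C1" "E \<noteq> C2" "E \<noteq> D1" "E \<noteq> D2" using E(2) nS unfolding Ceq by blast+
      then have nE: "v \<notin> E" "- v \<notin> E" using E(1) C(1) D(1) by blast+
      then have EH: "E \<in> restr (- v) F" using inH[OF E(1)] by simp
      \<comment> \<open>The node lemma is used with \<open>y\<close> and \<open>- x\<close> in the
        roles of its \<open>x\<close> and \<open>y\<close>, so that \<open>?E\<close> is the node. A
        clash is impossible since \<open>S\<close> falsifies both \<open>E\<close> and
        \<open>?E\<close>.\<close>
      have "(\<exists>z\<in>E. - z \<in> ?E) \<or> ?E \<subseteq> E"
        using deficiency_1_node[OF uH def1 H nR(3) _ EH] nvy(6) by (metis minus_minus)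
      moreover have "\<not> (\<exists>z\<in>E. - z \<in> ?E)" using S E(2) assignment_consistent by blast
      ultimately show "\<exists>D\<in>{E \<in> F. ?E \<subseteq> E}. D \<subseteq> S" using E by blast
    qed
  qed (use clE in auto)
  then have EF: "?E \<in> F" by blast
  let ?K = "{C1, C2, D1, D2, ?E}"
  have "?K = {R} \<or> ?K = F \<and> R = {}"
  proof (rule irreducible_covered_cube[OF cs irr _ clR(1)])
    show "covers ?K R"
      unfolding covers_def
    proof (intro allI impI)
      fix S assume S: "assignment S \<and> R \<subseteq> S"
      then have "v \<in> S \<or> - v \<in> S" "x \<in> S \<or> - x \<in> S" "y \<in> S \<or> - y \<in> S"
        using v0 clR by (auto simp: assignment_def)
      then have "C1 \<subseteq> S \<or> C2 \<subseteq> S \<or> D1 \<subseteq> S \<or> D2 \<subseteq> S \<or> ?E \<subseteq> S"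
        using S unfolding Ceq by auto
      then show "\<exists>D\<in>?K. D \<subseteq> S" by blast
    qed
    show "?K \<subseteq> F" using CF DF EF by blast
    show "R \<subseteq> D" if "D \<in> ?K" for D using that unfolding Ceq by blast
  qed
  moreover have "C1 \<noteq> R" using CF nvy by blast
  ultimately have "F = ?K" and R0: "R = {}" by blast+
  then have "F = cyc y v (- x)"
    unfolding Ceq R0 cyc_def by (auto simp: insert_commute)
  with nR nvy clR v0 show ?thesis
    by (intro exI[of _ y] exI[of _ v] exI[of _ "- x"]) auto
qed

lemma irreducible_deficiency_2_is_cyc:
  assumes u: "uhit F" and irr: "clause_irreducible F" and def2: "deficiency F = 2"
  shows "\<exists>a b c. F = cyc a b c \<and> a \<noteq> 0 \<and> b \<noteq> 0 \<and> c \<noteq> 0 \<and>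
    a \<noteq> b \<and> a \<noteq> - b \<and> a \<noteq> c \<and> a \<noteq> - c \<and> b \<noteq> c \<and> b \<noteq> - c"
proof -
  have cs: "clause_set F" using u by (simp add: uhit_def)
  have vne: "vars F \<noteq> {}"
  proof
    assume v: "vars F = {}"
    then have "F \<subseteq> {{}}" by (auto simp: vars_def)
    then have "card F \<le> 1" using card_mono[of "{{}}" F] by auto
    with def2 v show False by (simp add: deficiency_def)
  qed
  obtain v where v: "v \<in> vars F" "v \<noteq> 0"
    "\<And>l. \<bar>l\<bar> = v \<Longrightarrow> deficiency (restr l F) = deficiency F + 1 - int (card {C \<in> F. l \<in> C})"
    "\<And>l. \<bar>l\<bar> = v \<Longrightarrow> card (vars (restr l F)) < card (vars F)"
    "\<And>l. \<bar>l\<bar> = v \<Longrightarrow> 1 \<le> card {C \<in> F. l \<in> C} \<and> int (card {C \<in> F. l \<in> C}) \<le> deficiency F"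
    using low_degree_variable[OF u vne] by blast
  have c2: "card {C \<in> F. l \<in> C} = 2" if "\<bar>l\<bar> = v" for l
  proof -
    have "l \<noteq> 0" using that v(2) by auto
    \<comment> \<open>The number of occurrences is 1 or 2, and 1 is excluded.\<close>
    then have "card {C \<in> F. l \<in> C} \<noteq> 1" using irreducible_not_singular[OF u irr] def2 by simp
    with v(5)[OF that] def2 show ?thesis by simp
  qed
  have va: "\<bar>v\<bar> = v" "\<bar>- v\<bar> = v" using v(1) by (auto simp: vars_def)
  obtain C1 C2 where C: "{C \<in> F. v \<in> C} = {C1, C2}" "C1 \<noteq> C2"
    using c2[OF va(1)] by (metis card_2_iff)
  obtain D1 D2 where D: "{C \<in> F. - v \<in> C} = {D1, D2}" "D1 \<noteq> D2"
    using c2[OF va(2)] by (metis card_2_iff)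
  have CF: "C1 \<in> F" "v \<in> C1" "C2 \<in> F" "v \<in> C2" using C(1) by blast+
  have DF: "D1 \<in> F" "- v \<in> D1" "D2 \<in> F" "- v \<in> D2" using D(1) by blast+
  have cl: "clause C1" "clause C2" "clause D1" "clause D2" using uhit_clause[OF u] CF DF by auto
  have nv: "- v \<notin> C1" "- v \<notin> C2" "v \<notin> D1" "v \<notin> D2"
    using cl CF DF unfolding clause_def by (metis minus_minus)+
  have clAB: "clause (C1 - {v})" "clause (C2 - {v})" "clause (D1 - {- v})" "clause (D2 - {- v})"
    using cl clause_subset by blast+
  have def1: "deficiency (restr (- v) F) = 1" using v(3)[OF va(2)] c2[OF va(2)] def2 by simp
  have AB: "\<forall>S. assignment S \<longrightarrow>
    (C1 - {v} \<subseteq> S \<or> C2 - {v} \<subseteq> S \<longleftrightarrow> D1 - {- v} \<subseteq> S \<or> D2 - {- v} \<subseteq> S)"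
  proof (intro allI impI iffI)
    fix S assume S: "assignment S"
    assume "C1 - {v} \<subseteq> S \<or> C2 - {v} \<subseteq> S"
    then have "\<exists>D\<in>F. - v \<in> D \<and> D - {- v} \<subseteq> S"
      using flip_covered[OF u v(2) S CF(1,2)] flip_covered[OF u v(2) S CF(3,4)] by blast
    then show "D1 - {- v} \<subseteq> S \<or> D2 - {- v} \<subseteq> S" using D(1) by blast
  next
    fix S assume S: "assignment S"
    assume *: "D1 - {- v} \<subseteq> S \<or> D2 - {- v} \<subseteq> S"
    have "- v \<noteq> 0" using v(2) by simp
    then have "\<exists>C\<in>F. - (- v) \<in> C \<and> C - {- (- v)} \<subseteq> S"
      using * flip_covered[OF u _ S DF(1,2)] flip_covered[OF u _ S DF(3,4)] by blast
    then show "C1 - {v} \<subseteq> S \<or> C2 - {v} \<subseteq> S" using C(1) unfolding minus_minus by blast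
  qed
  obtain z where "z \<in> C1" "- z \<in> C2" using uhit_clash[OF u CF(1,3) C(2)] .
  with nv have z: "z \<in> C1 - {v}" "- z \<in> C2 - {v}" by auto
  then have z': "- z \<in> C2 - {v}" "- (- z) \<in> C1 - {v}" by auto
  obtain x where "x \<in> D1" "- x \<in> D2" using uhit_clash[OF u DF(1,3) D(2)] .
  with nv have x: "x \<in> D1 - {- v}" "- x \<in> D2 - {- v}" by auto
  then have x': "- x \<in> D2 - {- v}" "- (- x) \<in> D1 - {- v}" by auto
  have C': "{C \<in> F. v \<in> C} = {C2, C1}" "C2 \<noteq> C1" using C by auto
  have D': "{C \<in> F. - v \<in> C} = {D2, D1}" "D2 \<noteq> D1" using D by auto
  note core = irreducible_clash_is_cyc[OF u irr v(2)]
  show ?thesis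
  proof (cases "clause ((C1 - {v}) \<union> (D1 - {- v})) \<and> clause ((C1 - {v}) \<union> (D2 - {- v})) \<and>
      clause ((C2 - {v}) \<union> (D1 - {- v})) \<and> clause ((C2 - {v}) \<union> (D2 - {- v}))")
    case True
    then obtain R where R: "C1 - {v} = insert z R" "C2 - {v} = insert (- z) R"
      using cubes_all_compatible[OF clAB z x AB] by blast
    then have Ceq: "C1 = insert v (insert z R)" "C2 = insert v (insert (- z) R)"
      using CF by (metis insert_Diff)+
    \<comment> \<open>Without a clash between the pairs, \<open>C1\<close> and \<open>C2\<close> are
      the halves of \<open>insert v R\<close>, a nontrivial clause-factor.\<close>
    have "{C1, C2} = {insert v R} \<or> {C1, C2} = F \<and> insert v R = {}"
    proof (rule irreducible_covered_cube[OF cs irr])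
      show "clause (insert v R)" using cl(1) Ceq(1) by (auto simp: clause_insert)
      show "{C1, C2} \<subseteq> F" using CF by blast
      show "insert v R \<subseteq> D" if "D \<in> {C1, C2}" for D using that unfolding Ceq by blast
      show "covers {C1, C2} (insert v R)"
        unfolding covers_def
      proof (intro allI impI)
        fix S assume S: "assignment S \<and> insert v R \<subseteq> S"
        have "z \<noteq> 0" using cl(1) unfolding Ceq clause_insert by blast
        then have "z \<in> S \<or> - z \<in> S" using S by (auto simp: assignment_def)
        then have "C1 \<subseteq> S \<or> C2 \<subseteq> S" using S unfolding Ceq by blast
        then show "\<exists>D\<in>{C1, C2}. D \<subseteq> S" by blast
      qed
    qed
    then have False using C(2) by blast
    then show ?thesis ..
  next
    case False
    then consider w where "w \<in> C1 - {v}" "- w \<in> D1 - {- v}"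
      | w where "w \<in> C1 - {v}" "- w \<in> D2 - {- v}"
      | w where "w \<in> C2 - {v}" "- w \<in> D1 - {- v}"
      | w where "w \<in> C2 - {v}" "- w \<in> D2 - {- v}"
      using not_clash_clause_Un clAB by meson
    then show ?thesis
    proof cases
      case 1
      show ?thesis by (rule core[OF C D def1 AB z x 1])
    next
      case 2
      show ?thesis by (rule core[OF C D' def1 _ z x' 2]) (use AB in blast)
    next
      case 3
      show ?thesis by (rule core[OF C' D def1 _ z' x 3]) (use AB in blast)
    next
      case 4
      show ?thesis by (rule core[OF C' D' def1 _ z' x' 4]) (use AB in blast)
    qed
  qed
qed

section \<open>Isomorphism with \<open>D3\<close>\<close>

lemma D3_eq_cyc: "D3 = cyc 1 2 3"
  by (simp add: D3_def cyc_def)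

lemma lits_cyc: "lits (cyc a b c) = {a, - a, b, - b, c, - c}"
proof -
  have "vars (cyc a b c) = {\<bar>a\<bar>, \<bar>b\<bar>, \<bar>c\<bar>}" by (auto simp: vars_def cyc_def)
  then have "x \<in> lits (cyc a b c) \<longleftrightarrow> x \<in> {a, - a, b, - b, c, - c}" for x
    by (simp add: lits_def abs_eq_iff)
  then show ?thesis by blast
qed

lemma isomorphic_cyc_D3:
  assumes "a \<noteq> 0" "b \<noteq> 0" "c \<noteq> 0"
    "a \<noteq> b" "a \<noteq> - b" "a \<noteq> c" "a \<noteq> - c" "b \<noteq> c" "b \<noteq> - c"
  shows "isomorphic (cyc a b c) D3"
proof -
  \<comment> \<open>The last default \<open>- 3\<close> is meant for \<open>- c\<close>; values at
    other literals do not matter.\<close>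
  define f :: "int \<Rightarrow> int" where "f = (\<lambda>z. if z = a then 1 else if z = - a then - 1
    else if z = b then 2 else if z = - b then - 2 else if z = c then 3 else - 3)"
  have ne: "- a \<noteq> a" "- b \<noteq> b" "- c \<noteq> c"
    "- a \<noteq> b" "- a \<noteq> c" "- b \<noteq> c" "- b \<noteq> a" "- c \<noteq> a" "- c \<noteq> b"
    using assms by auto
  have f: "f a = 1" "f (- a) = - 1" "f b = 2" "f (- b) = - 2" "f c = 3" "f (- c) = - 3"
    using assms ne ne[symmetric] unfolding f_def by simp_all
  have "bij_betw f (lits (cyc a b c)) (lits D3)"
    unfolding bij_betw_def D3_eq_cyc lits_cyc
    by (auto simp: inj_on_def f)
  moreover have "\<forall>x\<in>lits (cyc a b c). f (- x) = - f x"
    unfolding lits_cyc by (simp add: f)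
  moreover have "{{f x | x. x \<in> C} | C. C \<in> cyc a b c} = (`) f ` cyc a b c"
    by (auto simp: image_def)
  then have "D3 = {{f x | x. x \<in> C} | C. C \<in> cyc a b c}"
    by (simp add: D3_eq_cyc cyc_def f)
  ultimately show ?thesis unfolding isomorphic_def by blast
qed

section \<open>Properties of \<open>D3\<close>\<close>

lemma satisfiableI: "clause C \<Longrightarrow> (\<And>D. D \<in> F \<Longrightarrow> C \<inter> D \<noteq> {}) \<Longrightarrow> satisfiable F"
  unfolding satisfiable_def by blast

lemma unsatisfiable_D3: "unsatisfiable D3"
  unfolding satisfiable_def D3_def clause_def by auto

lemma hitting_D3: "hitting D3"
  unfolding hitting_def D3_def by auto

lemma clause_set_D3: "clause_set D3"
  unfolding clause_set_def D3_def clause_def by simp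

lemma deficiency_D3: "deficiency D3 = 2"
proof -
  have "vars D3 = {1, 2, 3}" by (auto simp: vars_def D3_def)
  moreover have "card D3 = 5"
    unfolding D3_def by (simp add: card_insert_if set_eq_subset)
  ultimately show ?thesis by (simp add: deficiency_def)
qed

text \<open>A factor with empty intersection is unsatisfiable, and \<open>D3\<close> is minimally
  unsatisfiable. Otherwise its clauses share a literal, which occurs in only two clauses of
  \<open>D3\<close>, and these two together are no clause-factor.\<close>

lemma irreducible_D3: "clause_irreducible D3"
  unfolding clause_irreducible_def
proof (intro allI impI)
  fix K assume K: "clause_factor_of K D3"
  then have sub: "K \<subseteq> D3" and ne: "K \<noteq> {}" and un: "unsatisfiable {D - \<Inter> K | D. D \<in> K}"
    by (auto simp: clause_factor_of_def clause_factor_def)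
  show "trivial_factor K D3"
  proof (cases "\<Inter> K = {}")
    case True
    then have unK: "unsatisfiable K" using un by simp
    have "K = D3"
    proof (rule ccontr)
      assume "K \<noteq> D3"
      then obtain D where D: "D \<in> D3" "K \<subseteq> D3 - {D}" using sub by blast
      have "\<exists>C. clause C \<and> (\<forall>E\<in>D3. E \<noteq> D \<longrightarrow> C \<inter> E \<noteq> {})"
      proof -
        \<comment> \<open>Each witness contains the complements of all literals of the omitted
          clause \<open>D\<close>; for binary \<open>D\<close> the third literal is
          negative.\<close>
        have "clause {-1, -2, -3}" "clause {1, 2, 3}" "clause {1, -2, -3}" "clause {-1, 2, -3}"
          "clause {-1, -2, 3}" by (simp_all add: clause_def)
        with D(1) show ?thesis unfolding D3_def
          by (elim insertE emptyE)
            (rule exI[of _ "{-1,-2,-3}"] exI[of _ "{1,2,3}"] exI[of _ "{1,-2,-3}"]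
              exI[of _ "{-1,2,-3}"] exI[of _ "{-1,-2,3}"], simp; fail)+
      qed
      then obtain C where C: "clause C" "\<And>E. E \<in> D3 \<Longrightarrow> E \<noteq> D \<Longrightarrow> C \<inter> E \<noteq> {}" by metis
      have "satisfiable K" by (rule satisfiableI[OF C(1)]) (use C(2) D(2) in auto)
      with unK show False ..
    qed
    with unK show ?thesis by (simp add: trivial_factor_def)
  next
    case False
    then obtain x where x: "\<And>D. D \<in> K \<Longrightarrow> x \<in> D" by blast
    have "\<exists>P Q. {D \<in> D3. x \<in> D} \<subseteq> {P, Q} \<and> satisfiable {P - P \<inter> Q, Q - P \<inter> Q}"
    proof -
      obtain D where "D \<in> K" using ne by blast
      then have "x \<in> D" "D \<in> D3" using x sub by auto
      then consider "x = 1" | "x = 2" | "x = 3" | "x = -1" | "x = -2" | "x = -3"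
        by (auto simp: D3_def)
      \<comment> \<open>Without \<open>x\<close>, the binary clause is a unit clashing with the
        ternary one; the witness joins this unit with the other remaining literal of the ternary
        clause.\<close>
      then show ?thesis
      proof cases
        case 1
        show ?thesis
          by (intro exI[of _ "{1, 2, 3}"] exI[of _ "{-3, 1}"] conjI satisfiableI[of "{2, -3}"])
            (auto simp: 1 D3_def clause_def)
      next
        case 2
        show ?thesis
          by (intro exI[of _ "{1, 2, 3}"] exI[of _ "{-1, 2}"] conjI satisfiableI[of "{-1, 3}"])
            (auto simp: 2 D3_def clause_def)
      next
        case 3
        show ?thesis
          by (intro exI[of _ "{1, 2, 3}"] exI[of _ "{-2, 3}"] conjI satisfiableI[of "{1, -2}"])
            (auto simp: 3 D3_def clause_def)
      next
        case 4
        show ?thesis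
          by (intro exI[of _ "{-1, -2, -3}"] exI[of _ "{-1, 2}"] conjI satisfiableI[of "{2, -3}"])
            (auto simp: 4 D3_def clause_def)
      next
        case 5
        show ?thesis
          by (intro exI[of _ "{-1, -2, -3}"] exI[of _ "{-2, 3}"] conjI satisfiableI[of "{-1, 3}"])
            (auto simp: 5 D3_def clause_def)
      next
        case 6
        show ?thesis
          by (intro exI[of _ "{-1, -2, -3}"] exI[of _ "{-3, 1}"] conjI satisfiableI[of "{1, -2}"])
            (auto simp: 6 D3_def clause_def)
      qed
    qed
    then obtain P Q where PQ: "{D \<in> D3. x \<in> D} \<subseteq> {P, Q}" "satisfiable {P - P \<inter> Q, Q - P \<inter> Q}"
      by blast
    have "K \<subseteq> {P, Q}" using sub x PQ(1) by blast
    then consider "K = {P}" | "K = {Q}" | "K = {P, Q}" using ne by blast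
    then show ?thesis
    proof cases
      case 3
      then have "{D - \<Inter> K | D. D \<in> K} = {P - P \<inter> Q, Q - P \<inter> Q}" by auto
      with un PQ(2) show ?thesis by simp
    qed (simp_all add: trivial_factor_def)
  qed
qed

theorem lemma20:
  shows "clause_set D3 \<and> clause_irreducible D3 \<and> unsatisfiable D3 \<and> hitting D3 \<and>
           deficiency D3 = 2 \<and>
         (\<forall>F. clause_set F \<and> clause_irreducible F \<and> unsatisfiable F \<and> hitting F \<and>
           deficiency F = 2 \<longrightarrow> isomorphic F D3)"
proof (intro conjI allI impI)
  fix F assume F: "clause_set F \<and> clause_irreducible F \<and> unsatisfiable F \<and> hitting F \<and>
    deficiency F = 2"
  then have "uhit F" by (simp add: uhit_def)
  with F irreducible_deficiency_2_is_cyc isomorphic_cyc_D3 show "isomorphic F D3" by metis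
qed (rule clause_set_D3 irreducible_D3 unsatisfiable_D3 hitting_D3 deficiency_D3)+

end
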